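(* There exists a walk-regular finite simple connected undirected graph on $12$ vertices that contains two non-similar vertices (i.e., is not vertex-transitive), and every walk-regular finite simple connected undirected graph on fewer than $12$ vertices is vertex-transitive.
   Context: A finite simple graph with adjacency matrix $A$ is walk-regular if for every $k\ge 0$ the diagonal entry $(A^k)_{v,v}$ (the number of closed walks of length $k$ at $v$) is the same for all vertices $v$; equivalently, all pairs of vertices are cospectral. Two vertices are similar if some graph automorphism maps one to the other; a graph is vertex-transitive if every two vertices are similar. *)

theory Defs
  imports
    "Graph_Theory.Pair_Digraph"
    "Graph_Theory.Digraph_Component"
    "Graph_Theory.Digraph_Isomorphism"
    "Jordan_Normal_Form.Matrix"
begin

text \<open>
  A finite simple undirected graph is a \<open>pair_graph\<close>: finitely many vertices and a symmetric,
  irreflexive arc relation, each undirected edge being the two opposite arcs.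
\<close>

definition adj_mat :: "'a pair_pre_digraph \<Rightarrow> 'a list \<Rightarrow> int mat" where
  "adj_mat G vs =
     mat (length vs) (length vs) (\<lambda>(i, j). if (vs ! i, vs ! j) \<in> parcs G then 1 else 0)"

text \<open>
  Matrices are indexed by natural numbers, so the vertices are listed as \<open>vs\<close>. Another listing
  conjugates the adjacency matrix by a permutation matrix, so the condition does not depend on
  the choice of \<open>vs\<close>.
\<close>

definition walk_regular :: "'a pair_pre_digraph \<Rightarrow> bool" where
  "walk_regular G \<longleftrightarrow>
     (\<exists>vs. distinct vs \<and> set vs = pverts G \<and>
       (\<forall>k. \<forall>i < length vs. \<forall>j < length vs.
          (adj_mat G vs ^\<^sub>m k) $$ (i, i) = (adj_mat G vs ^\<^sub>m k) $$ (j, j)))"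

definition automorphism ::
    "'a pair_pre_digraph \<Rightarrow> ('a, 'a \<times> 'a, 'a, 'a \<times> 'a) digraph_isomorphism \<Rightarrow> bool" where
  "automorphism G f \<longleftrightarrow>
     pre_digraph.digraph_isomorphism (with_proj G) f \<and> app_iso f (with_proj G) = with_proj G"

definition similar :: "'a pair_pre_digraph \<Rightarrow> 'a \<Rightarrow> 'a \<Rightarrow> bool" where
  "similar G u v \<longleftrightarrow> (\<exists>f. automorphism G f \<and> iso_verts f u = v)"

definition vertex_transitive :: "'a pair_pre_digraph \<Rightarrow> bool" where
  "vertex_transitive G \<longleftrightarrow> (\<forall>u \<in> pverts G. \<forall>v \<in> pverts G. similar G u v)"

text \<open>
  The arc map of an automorphism is determined by its vertex map, so automorphisms are the
  adjacency-preserving permutations of the vertices.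
\<close>

lemma (in pair_graph) similar_iff:
  "similar G u v \<longleftrightarrow>
     (\<exists>p. bij_betw p (pverts G) (pverts G) \<and>
          (\<forall>x \<in> pverts G. \<forall>y \<in> pverts G. (p x, p y) \<in> parcs G \<longleftrightarrow> (x, y) \<in> parcs G) \<and>
          p u = v)"
    (is "_ \<longleftrightarrow> (\<exists>p. ?P p)")
proof
  assume "similar G u v"
  then obtain f where f: "pre_digraph.digraph_isomorphism (with_proj G) f"
    "app_iso f (with_proj G) = with_proj G" "iso_verts f u = v"
    by (auto simp: similar_def automorphism_def)
  define p where "p = iso_verts f"
  have V: "p ` pverts G = pverts G" and A: "iso_arcs f ` parcs G = parcs G"
    and t: "iso_tail f = fst" and h: "iso_head f = snd"
    using f(2) by (auto simp: app_iso_def with_proj_def p_def)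
  have inj: "inj_on p (pverts G)"
    using f(1) by (simp add: pre_digraph.digraph_isomorphism_def p_def)
  have "iso_arcs f a = (p (fst a), p (snd a))" if "a \<in> parcs G" for a
    using f(1) that by (simp add: pre_digraph.digraph_isomorphism_def p_def t h prod_eq_iff)
  then have A': "(\<lambda>(x, y). (p x, p y)) ` parcs G = parcs G"
    using A by (metis (no_types, lifting) case_prod_unfold image_cong)
  have "(p x, p y) \<in> parcs G \<longleftrightarrow> (x, y) \<in> parcs G" if "x \<in> pverts G" "y \<in> pverts G" for x y
  proof
    assume "(p x, p y) \<in> parcs G"
    then obtain x' y' where *: "(x', y') \<in> parcs G" "p x = p x'" "p y = p y'"
      using A' by force
    then have "x = x'" "y = y'"
      using inj that by (auto dest: in_arcsD1 in_arcsD2 inj_onD)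
    with * show "(x, y) \<in> parcs G" by simp
  next
    assume "(x, y) \<in> parcs G"
    then show "(p x, p y) \<in> parcs G" using A' by force
  qed
  then show "\<exists>p. ?P p"
    using V inj f(3) by (intro exI[of _ p]) (auto simp: bij_betw_def p_def)
next
  assume "\<exists>p. ?P p"
  then obtain p where p: "?P p" ..
  let ?f = "\<lparr>iso_verts = p, iso_arcs = map_prod p p, iso_head = snd, iso_tail = fst\<rparr>"
  have V: "p ` pverts G = pverts G" and inj: "inj_on p (pverts G)"
    using p by (auto simp: bij_betw_def)
  have "map_prod p p ` parcs G = parcs G"
  proof (intro equalityI subsetI)
    fix a assume "a \<in> map_prod p p ` parcs G"
    then show "a \<in> parcs G" using p by (auto dest: in_arcsD1 in_arcsD2)
  next
    fix a assume a: "a \<in> parcs G"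
    then have "fst a \<in> p ` pverts G" "snd a \<in> p ` pverts G"
      unfolding V by (auto dest: in_arcsD1 in_arcsD2)
    then obtain x y where xy: "x \<in> pverts G" "y \<in> pverts G" "a = (p x, p y)"
      by (cases a) auto
    then have "(x, y) \<in> parcs G" using p a by auto
    with xy show "a \<in> map_prod p p ` parcs G" by force
  qed
  moreover have "inj_on (map_prod p p) (parcs G)"
    using map_prod_inj_on[OF inj inj]
    by (rule inj_on_subset) (auto dest: in_arcsD1 in_arcsD2)
  ultimately have "automorphism G ?f"
    using V inj wf_digraph
    by (auto simp: automorphism_def pre_digraph.digraph_isomorphism_def app_iso_def with_proj_def)
  then show "similar G u v"
    using p unfolding similar_def by (intro exI[of _ ?f]) simp
qed

end

theory Submission
  imports Defs "HOL-Combinatorics.Permutations"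
begin

text \<open>
  The complement of a walk-regular graph is walk-regular with the same automorphisms, so on fewer
  than 12 vertices one may assume that the degree is less than half the order. Such graphs are
  enumerated by choosing the adjacency rows one after the other. Two yet untreated vertices with the
  same neighbours among the treated ones are interchangeable, and the number \<open>w\<close> of closed walks of
  length 3 at a vertex is fixed in advance; it is even, and 3 divides \<open>n * w\<close>. Any vertex can serve
  as the root, that is, as the first vertex to be treated. It turns out that among the few graphs
  found, the numbers of closed walks of lengths 4 and 5 determine the rooted isomorphism type. As
  these numbers do not depend on the root, any two vertices are similar.

  For the 12-vertex graph, \<open>A\<^sup>3 = 4A + 4J\<close> reduces walk-regularity to walks of length at most 2.
  Vertex 0 has a neighbour with which it has no common neighbour, while vertex 2 has no such
  neighbour.
\<close>

section \<open>Closed walks\<close>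

text \<open>Indicator sums stay sums over the whole index range, ready for swapping and splitting;
  the default rules turn them into cardinalities and sums over intersections.\<close>

declare sum_of_bool_eq [simp del] sum_mult_of_bool_eq [simp del] sum_of_bool_mult_eq [simp del]

text \<open>For \<open>u\<close> and \<open>v\<close> below \<open>n\<close> this is the entry of
  A^k at (u, v), with A the adjacency matrix of \<open>E\<close> on \<open>{..<n}\<close>.\<close>

fun walk :: "nat \<Rightarrow> (nat \<Rightarrow> nat \<Rightarrow> bool) \<Rightarrow> nat \<Rightarrow> nat \<Rightarrow> nat \<Rightarrow> int" where
  "walk n E 0 u v = of_bool (u = v)"
| "walk n E (Suc k) u v = (\<Sum>x<n. walk n E k u x * of_bool (E x v))"

definition walk_const :: "nat \<Rightarrow> (nat \<Rightarrow> nat \<Rightarrow> bool) \<Rightarrow> bool" where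
  "walk_const n E \<longleftrightarrow> (\<forall>k. \<exists>c. \<forall>u<n. walk n E k u u = c)"

lemma sum_of_bool_delta:
  fixes f :: "nat \<Rightarrow> 'a::semiring_1"
  shows "v < n \<Longrightarrow> (\<Sum>x<n. f x * of_bool (x = v)) = f v"
    and "v < n \<Longrightarrow> (\<Sum>x<n. of_bool (v = x) * f x) = f v"
  by (simp_all add: of_bool_def if_distrib[of "(*) _"] if_distrib[of "\<lambda>y. y * _"] cong: if_cong)

lemma walk_add:
  assumes "v < n"
  shows "walk n E (j + k) u v = (\<Sum>x<n. walk n E j u x * walk n E k x v)"
  using assms
proof (induction k arbitrary: v)
  case 0
  then show ?case by (simp add: sum_of_bool_delta)
next
  case (Suc k)
  have "walk n E (j + Suc k) u v = (\<Sum>y<n. (\<Sum>x<n. walk n E j u x * walk n E k x y) * of_bool (E y v))"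
    by (simp add: Suc.IH)
  also have "\<dots> = (\<Sum>x<n. \<Sum>y<n. walk n E j u x * (walk n E k x y * of_bool (E y v)))"
    by (subst sum.swap) (simp add: sum_distrib_right mult.assoc)
  finally show ?case by (simp add: sum_distrib_left)
qed

lemma walk_1: "u < n \<Longrightarrow> walk n E (Suc 0) u v = of_bool (E u v)"
  by (simp add: sum_of_bool_delta)

lemma walk_Suc_left:
  assumes "u < n" "v < n"
  shows "walk n E (Suc k) u v = (\<Sum>x<n. of_bool (E u x) * walk n E k x v)"
  using walk_add[of v n E "Suc 0" k u] assms by (simp add: walk_1 del: walk.simps)

lemma walk_sym:
  assumes "symp E" "u < n" "v < n"
  shows "walk n E k u v = walk n E k v u"
  using assms(2,3)
proof (induction k arbitrary: u v)
  case (Suc k)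
  have "walk n E (Suc k) u v = (\<Sum>x<n. of_bool (E v x) * walk n E k x u)"
    using Suc assms(1) by (auto intro!: sum.cong simp: mult.commute dest: sympD)
  then show ?case
    using Suc.prems by (simp add: walk_Suc_left del: walk.simps)
qed auto

text \<open>The all-ones vector is an eigenvector of A with eigenvalue \<open>r\<close>.\<close>

lemma walk_row_sum:
  assumes r: "\<And>x. x < n \<Longrightarrow> (\<Sum>y<n. of_bool (E x y)) = (r::int)" and "u < n"
  shows "(\<Sum>v<n. walk n E k u v) = r ^ k"
proof (induction k)
  case 0
  then show ?case
    using sum_of_bool_delta(2)[of u n "\<lambda>_. 1::int"] \<open>u < n\<close> by simp
next
  case (Suc k)
  have "(\<Sum>v<n. walk n E (Suc k) u v) = (\<Sum>x<n. walk n E k u x * (\<Sum>v<n. of_bool (E x v)))"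
    by (simp add: sum_distrib_left) (rule sum.swap)
  also have "\<dots> = (\<Sum>x<n. walk n E k u x) * r"
    by (simp add: r sum_distrib_right)
  finally show ?case using Suc by simp
qed

lemma walk_permute:
  assumes "p permutes {..<n}"
  shows "walk n (\<lambda>i j. E (p i) (p j)) k u v = walk n E k (p u) (p v)"
proof (induction k arbitrary: v)
  case 0
  then show ?case using permutes_inj[OF assms] by (auto dest: injD)
next
  case (Suc k)
  then show ?case
    by (simp add: sum.permute[OF assms, of "\<lambda>x. walk n E k (p u) x * of_bool (E x (p v))"])
qed

section \<open>Walk-regularity of the complement\<close>

definition compl :: "(nat \<Rightarrow> nat \<Rightarrow> bool) \<Rightarrow> nat \<Rightarrow> nat \<Rightarrow> bool" where
  "compl E i j \<longleftrightarrow> i \<noteq> j \<and> \<not> E i j"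

lemma of_bool_compl:
  "\<not> E i i \<Longrightarrow> (of_bool (compl E i j) :: 'a::ring_1) = 1 - of_bool (i = j) - of_bool (E i j)"
  by (auto simp: compl_def)

text \<open>
  With \<open>A\<close> and \<open>J - I - A\<close> the two adjacency matrices, \<open>A\<^sup>j(J - I - A)\<^sup>k\<close> has constant diagonal for
  all \<open>j\<close> and \<open>k\<close>, by induction on \<open>k\<close>; the matrix \<open>J\<close> does no harm because all row sums are constant.
\<close>
lemma walk_const_compl:
  assumes sym: "symp E" and irr: "irreflp E" and wc: "walk_const n E"
  shows "walk_const n (compl E)"
proof -
  \<comment> \<open>Closed walks of length 2 count the degree, so all row sums of A agree; this is
    what makes products with J harmless.\<close>
  have deg: "walk n E 2 x x = (\<Sum>y<n. of_bool (E x y))" if "x < n" for x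
  proof -
    have "walk n E 2 x x = (\<Sum>y<n. of_bool (E x y) * walk n E (Suc 0) y x)"
      using walk_Suc_left[OF that that, of E "Suc 0"] by (simp only: numeral_2_eq_2)
    also have "\<dots> = (\<Sum>y<n. of_bool (E x y))"
      by (intro sum.cong refl, subst walk_1) (use sym in \<open>auto dest: sympD\<close>)
    finally show ?thesis .
  qed
  obtain r where "walk n E 2 x x = r" if "x < n" for x
    using wc unfolding walk_const_def by blast
  then have r: "(\<Sum>y<n. of_bool (E x y)) = r" if "x < n" for x
    using deg[OF that] that by simp
  have E: "\<not> E x x" for x using irr by (simp add: irreflpD)
  have symc: "symp (compl E)" using sym by (auto simp: symp_def compl_def)
  define s where "s = int n - 1 - r"
  have s: "(\<Sum>y<n. of_bool (compl E x y)) = s" if "x < n" for x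
    using that r[OF that] sum_of_bool_delta(2)[of x n "\<lambda>_. 1::int"]
    by (simp add: of_bool_compl[OF E] sum_subtractf s_def)
  \<comment> \<open>\<open>X j k u\<close> is the diagonal entry at \<open>u\<close> of A^j (J - I -
    A)^k.\<close>
  define X where "X j k u = (\<Sum>x<n. walk n E j u x * walk n (compl E) k x u)" for j k u
  \<comment> \<open>Expand the leftmost factor J - I - A of the second power: J gives the product of
    a row sum of A^j and a column sum of (J - I - A)^k, I gives \<open>X j k\<close>, and A is
    absorbed into A^j.\<close>
  have X_Suc: "X j (Suc k) u = r ^ j * s ^ k - X j k u - X (Suc j) k u" if u: "u < n" for j k u
  proof -
    have "X j (Suc k) u = (\<Sum>x<n. walk n E j u x * (\<Sum>y<n. of_bool (compl E x y) * walk n (compl E) k y u))"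
      unfolding X_def using u by (intro sum.cong refl) (simp add: walk_Suc_left del: walk.simps)
    also have "\<dots> = (\<Sum>x<n. walk n E j u x * (s ^ k - walk n (compl E) k x u -
        (\<Sum>y<n. of_bool (E x y) * walk n (compl E) k y u)))"
    proof (intro sum.cong refl arg_cong[of _ _ "(*) _"])
      fix x assume x: "x \<in> {..<n}"
      have "(\<Sum>y<n. walk n (compl E) k y u) = s ^ k"
        using walk_row_sum[of n "compl E" s u k] s u walk_sym[OF symc u, of _ k] by simp
      then show "(\<Sum>y<n. of_bool (compl E x y) * walk n (compl E) k y u) = 
         s ^ k - walk n (compl E) k x u - (\<Sum>y<n. of_bool (E x y) * walk n (compl E) k y u)"
        using x sum_of_bool_delta(2)[of x n "\<lambda>y. walk n (compl E) k y u"]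
        by (simp add: of_bool_compl[OF E] left_diff_distrib sum_subtractf)
    qed
    also have "\<dots> = (\<Sum>x<n. walk n E j u x) * s ^ k - X j k u -
        (\<Sum>x<n. \<Sum>y<n. walk n E j u x * of_bool (E x y) * walk n (compl E) k y u)"
      unfolding X_def
      by (simp add: right_diff_distrib sum_subtractf sum_distrib_right sum_distrib_left mult.assoc)
    also have "(\<Sum>x<n. \<Sum>y<n. walk n E j u x * of_bool (E x y) * walk n (compl E) k y u) = X (Suc j) k u"
      unfolding X_def by (subst sum.swap) (simp add: sum_distrib_right)
    finally show ?thesis using walk_row_sum[of n E r u j] r u by simp
  qed
  have "\<exists>c. \<forall>u<n. X j k u = c" for j k
  proof (induction k arbitrary: j)
    case 0
    have "X j 0 u = walk n E j u u" if "u < n" for u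
      using that by (simp add: X_def sum_of_bool_delta)
    moreover obtain c where "\<forall>u<n. walk n E j u u = c"
      using wc unfolding walk_const_def by blast
    ultimately show ?case by auto
  next
    case (Suc k)
    obtain c d where "\<forall>u<n. X j k u = c" "\<forall>u<n. X (Suc j) k u = d"
      using Suc by blast
    then show ?case by (auto simp: X_Suc)
  qed
  moreover have "X 0 k u = walk n (compl E) k u u" if "u < n" for k u
    using that by (simp add: X_def sum_of_bool_delta)
  ultimately show ?thesis unfolding walk_const_def by (metis (no_types))
qed

text \<open>The new last row and last column contribute equal amounts. This serves both the
  handshake lemma and the parity of \<open>w\<close>.\<close>

lemma even_sum_symmetric:
  fixes m :: "nat \<Rightarrow> nat \<Rightarrow> nat"
  assumes "\<And>i j. m i j = m j i" and "\<And>i. m i i = 0"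
  shows "even (\<Sum>i<n. \<Sum>j<n. m i j)"
proof (induction n)
  case (Suc n)
  have "(\<Sum>i<n. m i n) = (\<Sum>i<n. m n i)"
    by (rule sum.cong[OF refl assms(1)])
  then have "(\<Sum>i<Suc n. \<Sum>j<Suc n. m i j) = (\<Sum>i<n. \<Sum>j<n. m i j) + 2 * (\<Sum>j<n. m n j)"
    by (simp add: sum.distrib assms(2))
  then show ?case by (simp only:) (use Suc in simp)
qed auto

text \<open>A triple that contributes contains the new index at most once, and the three positions
  of that index give equal sums by rotation. Applied to ordered triangles below.\<close>

lemma three_dvd_sum_cyclic:
  fixes m :: "nat \<Rightarrow> nat \<Rightarrow> nat \<Rightarrow> nat"
  assumes cyc: "\<And>i j k. m i j k = m j k i" and "\<And>i k. m i i k = 0"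
  shows "3 dvd (\<Sum>i<n. \<Sum>j<n. \<Sum>k<n. m i j k)"
proof (induction n)
  case (Suc n)
  have 0: "m n n k = 0" "m k n n = 0" "m n k n = 0" for k
    using assms(2)[of n k] cyc[of k n n] cyc[of n k n] by simp_all
  have "(\<Sum>i<n. \<Sum>k<n. m i n k) = (\<Sum>k<n. \<Sum>i<n. m n k i)"
    by (subst sum.swap) (simp add: cyc[of _ n])
  moreover have "(\<Sum>i<n. \<Sum>j<n. m i j n) = (\<Sum>i<n. \<Sum>j<n. m n i j)"
    by (simp add: cyc[of n])
  ultimately have "(\<Sum>i<Suc n. \<Sum>j<Suc n. \<Sum>k<Suc n. m i j k) =
      (\<Sum>i<n. \<Sum>j<n. \<Sum>k<n. m i j k) + 3 * (\<Sum>i<n. \<Sum>j<n. m n i j)"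
    using 0 by (simp add: sum.distrib)
  with Suc show ?case by simp
qed auto

section \<open>Adjacency rows\<close>

text \<open>Graphs become lists of Boolean rows, with counting by list recursion, so that the search
  can be evaluated.\<close>

definition nbr_row :: "nat \<Rightarrow> (nat \<Rightarrow> nat \<Rightarrow> bool) \<Rightarrow> nat \<Rightarrow> bool list" where
  "nbr_row n E i = map (E i) [0..<n]"

definition nbr_rows :: "nat \<Rightarrow> (nat \<Rightarrow> nat \<Rightarrow> bool) \<Rightarrow> bool list list" where
  "nbr_rows n E = map (nbr_row n E) [0..<n]"

fun trues :: "bool list \<Rightarrow> nat" where
  "trues [] = 0"
| "trues (b # bs) = (if b then Suc (trues bs) else trues bs)"

fun common :: "bool list \<Rightarrow> bool list \<Rightarrow> nat" where
  "common (a # as) (b # bs) = (if a \<and> b then Suc (common as bs) else common as bs)"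
| "common _ _ = 0"

abbreviation codeg :: "nat \<Rightarrow> (nat \<Rightarrow> nat \<Rightarrow> bool) \<Rightarrow> nat \<Rightarrow> nat \<Rightarrow> nat" where
  "codeg n E i j \<equiv> common (nbr_row n E i) (nbr_row n E j)"

lemma trues_map: "distinct xs \<Longrightarrow> trues (map f xs) = (\<Sum>x\<in>set xs. of_bool (f x))"
  by (induction xs) auto

lemma trues_append: "trues (xs @ ys) = trues xs + trues ys"
  by (induction xs) auto

lemma trues_rev: "trues (rev xs) = trues xs"
  by (induction xs) (auto simp: trues_append)

lemma common_map:
  "distinct xs \<Longrightarrow> common (map f xs) (map g xs) = (\<Sum>x\<in>set xs. of_bool (f x) * of_bool (g x))"
  by (induction xs) auto

lemma codeg_eq: "codeg n E i j = (\<Sum>x<n. of_bool (E i x) * of_bool (E j x))"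
  by (simp add: nbr_row_def common_map lessThan_atLeast0)

lemma codeg_commute: "codeg n E i j = codeg n E j i"
  by (simp add: codeg_eq mult.commute)

text \<open>Constancy of the closed walks of lengths 2 and 3 only: \<open>r\<close> is the degree
  and \<open>w\<close> is twice the number of triangles at a vertex. The pruning in the search
  relies on just these two numbers.\<close>

definition regular :: "nat \<Rightarrow> nat \<Rightarrow> nat \<Rightarrow> (nat \<Rightarrow> nat \<Rightarrow> bool) \<Rightarrow> bool" where
  "regular n r w E \<longleftrightarrow> symp E \<and> irreflp E \<and>
     (\<forall>i<n. (\<Sum>j<n. of_bool (E i j)) = r) \<and>
     (\<forall>i<n. (\<Sum>j<n. of_bool (E i j) * codeg n E i j) = w)"

lemma codeg_permute:
  assumes "p permutes {..<n}"
  shows "codeg n (\<lambda>i j. E (p i) (p j)) i j = codeg n E (p i) (p j)"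
  by (simp add: codeg_eq
      sum.permute[OF assms, of "\<lambda>x. of_bool (E (p i) x) * of_bool (E (p j) x)"])

lemma regular_permute:
  assumes p: "p permutes {..<n}" and "regular n r w E"
  shows "regular n r w (\<lambda>i j. E (p i) (p j))"
proof -
  have lt: "p i < n" if "i < n" for i using permutes_in_image[OF p] that by auto
  have "(\<Sum>j<n. of_bool (E (p i) (p j))) = r" if "i < n" for i
    using assms(2) lt[OF that] sum.permute[OF p, of "\<lambda>x. of_bool (E (p i) x) :: nat"]
    by (simp add: regular_def)
  moreover have "(\<Sum>j<n. of_bool (E (p i) (p j)) * codeg n (\<lambda>i j. E (p i) (p j)) i j) = w" if "i < n" for i
    using assms(2) lt[OF that] sum.permute[OF p, of "\<lambda>x. of_bool (E (p i) x) * codeg n E (p i) x"]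
    by (simp add: regular_def codeg_permute[OF p])
  ultimately show ?thesis
    using assms(2) by (simp add: regular_def symp_def irreflp_def)
qed

text \<open>Among the \<open>r\<close> neighbours of \<open>i\<close>, the vertex \<open>j\<close>
  is not a neighbour of itself.\<close>

lemma codeg_less:
  assumes "regular n r w E" "E i j" "i < n" "j < n"
  shows "codeg n E i j \<le> r - 1"
proof -
  have "codeg n E i j \<le> (\<Sum>x\<in>{..<n} - {j}. of_bool (E i x))"
    using assms by (subst codeg_eq, subst sum.remove[of _ j])
      (auto simp: regular_def irreflp_def of_bool_def intro!: sum_mono split: if_splits)
  also have "\<dots> + 1 = (\<Sum>x<n. of_bool (E i x))"
    using assms(2,4) sum.remove[of "{..<n}" j "\<lambda>x. of_bool (E i x) :: nat"] by simp
  also have "\<dots> = r" using assms(1,3) by (simp add: regular_def)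
  finally show ?thesis by simp
qed

section \<open>The search\<close>

text \<open>
  \<open>choices k B cs\<close> lists the sets of \<open>k\<close> columns of \<open>cs\<close> in which no chosen column follows an
  equal one that
  was left out; \<open>B\<close> collects the columns left out so far.
\<close>
fun choices :: "nat \<Rightarrow> bool list list \<Rightarrow> bool list list \<Rightarrow> bool list list" where
  "choices k B [] = (if k = 0 then [[]] else [])"
| "choices k B (c # cs) =
    (if k = 0 \<or> c \<in> set B then [] else map ((#) True) (choices (k - 1) B cs)) @
    map ((#) False) (choices k (c # B) cs)"

text \<open>The condition on \<open>B\<close> is the invariant of the induction: when
  \<open>c\<close> is left out, the twin condition against position 0 extends it to
  \<open>c # B\<close>.\<close>

lemma choices_complete:
  assumes "length S = length cs"
    and "\<And>a. a < length cs \<Longrightarrow> S ! a \<Longrightarrow> cs ! a \<notin> set B"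
    and "\<And>a b. a < length cs \<Longrightarrow> b < a \<Longrightarrow> S ! a \<Longrightarrow> \<not> S ! b \<Longrightarrow> cs ! a \<noteq> cs ! b"
  shows "S \<in> set (choices (trues S) B cs)"
  using assms
proof (induction cs arbitrary: S B)
  case (Cons c cs)
  obtain s S' where S: "S = s # S'" "length S' = length cs"
    using Cons.prems(1) by (cases S) auto
  have twin: "cs ! a \<noteq> cs ! b" if "a < length cs" "b < a" "S' ! a" "\<not> S' ! b" for a b
    using Cons.prems(3)[of "Suc a" "Suc b"] that S by simp
  show ?case
  proof (cases s)
    case True
    have "cs ! a \<notin> set B" if "a < length cs" "S' ! a" for a
      using Cons.prems(2)[of "Suc a"] that S by simp
    then have "S' \<in> set (choices (trues S') B cs)"
      using Cons.IH[OF S(2)] twin by blast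
    moreover have "c \<notin> set B" using Cons.prems(2)[of 0] S True by simp
    ultimately show ?thesis using S True by simp
  next
    case False
    have "cs ! a \<notin> set (c # B)" if "a < length cs" "S' ! a" for a
      using Cons.prems(2)[of "Suc a"] Cons.prems(3)[of "Suc a" 0] that S False by simp
    then have "S' \<in> set (choices (trues S') (c # B) cs)"
      using Cons.IH[OF S(2)] twin by blast
    then show ?thesis using S False by simp
  qed
qed auto

text \<open>
  An entry \<open>(R, T, b)\<close> stands for a treated vertex: \<open>R\<close> is its row, \<open>T\<close> the part of \<open>R\<close> belonging to the
  untreated vertices, and \<open>b\<close> counts the closed walks of length 3 starting at it whose first step
  leads to a treated vertex. As adjacent vertices have at most \<open>s = r - 1\<close> common neighbours, the
  final count \<open>w\<close> lies between the two bounds in \<open>feasible\<close>.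
\<close>
type_synonym entry = "bool list \<times> bool list \<times> nat"

fun feasible :: "nat \<Rightarrow> nat \<Rightarrow> entry \<Rightarrow> bool" where
  "feasible s w (R, T, b) \<longleftrightarrow> b \<le> w \<and> w \<le> b + s * trues T"

text \<open>\<open>hd T\<close> is the adjacency to the vertex being treated. Both rows are complete
  by then, so the common neighbours can be counted and are credited to both vertices.\<close>

fun gain :: "bool list \<Rightarrow> entry \<Rightarrow> nat" where
  "gain R (R', T, b) = (if hd T then common R R' else 0)"

fun upd :: "entry \<Rightarrow> nat \<Rightarrow> entry" where
  "upd (R, T, b) d = (R, tl T, b + d)"

definition advance :: "bool list \<Rightarrow> bool list \<Rightarrow> entry list \<Rightarrow> entry list" where
  "advance R S ds = (let D = map (gain R) ds in (R, S, sum_list D) # map2 upd ds D)"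

text \<open>Each column lists the adjacencies of an untreated vertex to the treated ones, latest
  first. The head column \<open>c\<close> is by symmetry the left part of the next row, so only the
  part \<open>S\<close> right of the diagonal is chosen.\<close>

fun search :: "nat \<Rightarrow> nat \<Rightarrow> entry list \<Rightarrow> bool list list \<Rightarrow> bool list list list" where
  "search r w ds [] = [rev (map fst ds)]"
| "search r w ds (c # cs) =
    (if r < trues c then []
     else concat (map (\<lambda>S. let ds' = advance (rev c @ False # S) S ds in
            if list_all (feasible (r - 1) w) ds' then search r w ds' (map2 (#) S cs) else [])
          (choices (r - trues c) [] cs)))"

text \<open>\<open>entry\<close>, \<open>entries\<close> and \<open>columns\<close> read off from a
  given graph the search state reached once the vertices below \<open>i\<close> have been
  treated.\<close>

definition entry :: "nat \<Rightarrow> (nat \<Rightarrow> nat \<Rightarrow> bool) \<Rightarrow> nat \<Rightarrow> nat \<Rightarrow> entry" where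
  "entry n E i x = (nbr_row n E x, map (E x) [i..<n], \<Sum>y<i. of_bool (E x y) * codeg n E x y)"

definition entries :: "nat \<Rightarrow> (nat \<Rightarrow> nat \<Rightarrow> bool) \<Rightarrow> nat \<Rightarrow> entry list" where
  "entries n E i = map (entry n E i) (rev [0..<i])"

definition columns :: "nat \<Rightarrow> (nat \<Rightarrow> nat \<Rightarrow> bool) \<Rightarrow> nat \<Rightarrow> bool list list" where
  "columns n E i = map (\<lambda>j. map (E j) (rev [0..<i])) [i..<n]"

lemma advance_entries:
  assumes "symp E" "irreflp E" "i < n"
  shows "advance (nbr_row n E i) (map (E i) [Suc i..<n]) (entries n E i) = entries n E (Suc i)"
proof -
  have hd: "hd (map (E x) [i..<n]) = E x i" and tl: "tl (map (E x) [i..<n]) = map (E x) [Suc i..<n]" for x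
    using assms(3) by (simp_all add: upt_conv_Cons)
  have sym: "E x i = E i x" for x using assms(1) by (metis sympD)
  have g: "gain (nbr_row n E i) (entry n E i x) = of_bool (E i x) * codeg n E i x" for x
    unfolding entry_def by (simp add: hd sym)
  have u: "upd (entry n E i x) (of_bool (E i x) * codeg n E i x) = entry n E (Suc i) x" for x
    unfolding entry_def by (simp add: tl sym codeg_commute[of n E i])
  \<comment> \<open>The range may include \<open>i\<close> itself, because its term vanishes by
    irreflexivity.\<close>
  have "sum_list (map (\<lambda>x. of_bool (E i x) * codeg n E i x) (rev [0..<i])) =
      (\<Sum>x<Suc i. of_bool (E i x) * codeg n E i x)"
    using assms(2) by (subst sum_list_distinct_conv_sum_set)
      (auto simp: irreflp_def lessThan_atLeast0)
  then show ?thesis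
    by (simp add: advance_def entries_def o_def g map2_map_map u entry_def[of n E "Suc i" i])
qed

lemma nbr_row_split:
  assumes "irreflp E" "i < n"
  shows "nbr_row n E i = rev (map (E i) (rev [0..<i])) @ False # map (E i) [Suc i..<n]"
proof -
  have "[0..<n] = [0..<i] @ i # [Suc i..<n]"
    using assms(2) upt_add_eq_append[of 0 i "n - i"] by (simp add: upt_conv_Cons)
  then show ?thesis
    using assms(1) by (simp add: nbr_row_def rev_map irreflp_def)
qed

lemma columns_Cons:
  "i < n \<Longrightarrow> columns n E i = map (E i) (rev [0..<i]) # map (\<lambda>j. map (E j) (rev [0..<i])) [Suc i..<n]"
  by (simp add: columns_def upt_conv_Cons)

lemma columns_Suc:
  assumes "symp E"
  shows "map2 (#) (map (E i) [Suc i..<n]) (map (\<lambda>j. map (E j) (rev [0..<i])) [Suc i..<n]) =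
    columns n E (Suc i)"
  using assms by (auto simp: map2_map_map columns_def symp_def)

lemma sum_lessThan_split:
  fixes f :: "nat \<Rightarrow> 'a::comm_monoid_add"
  shows "m \<le> n \<Longrightarrow> sum f {..<n} = sum f {..<m} + sum f {m..<n}"
  by (metis lessThan_atLeast0 sum.atLeastLessThan_concat zero_le)

lemma entries_feasible:
  assumes "regular n r w E" "i \<le> n"
  shows "list_all (feasible (r - 1) w) (entries n E i)"
proof -
  have "feasible (r - 1) w (entry n E i x)" if "x < i" for x
  proof -
    have w: "(\<Sum>y<i. of_bool (E x y) * codeg n E x y) +
        (\<Sum>y=i..<n. of_bool (E x y) * codeg n E x y) = w"
      using assms that sum_lessThan_split[OF assms(2), of "\<lambda>y. of_bool (E x y) * codeg n E x y"]
      by (simp add: regular_def)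
    have "(\<Sum>y=i..<n. of_bool (E x y) * codeg n E x y) \<le> (\<Sum>y=i..<n. (r - 1) * of_bool (E x y))"
      using codeg_less[OF assms(1)] assms(2) that by (intro sum_mono) auto
    also have "\<dots> = (r - 1) * trues (map (E x) [i..<n])"
      by (simp add: trues_map sum_distrib_left)
    finally show ?thesis using w unfolding entry_def by simp
  qed
  then show ?thesis by (simp add: entries_def list_all_iff)
qed

text \<open>
  Among all relabellings that agree with \<open>E\<close> on the rows below \<open>i\<close>, one whose \<open>i\<close>-th row has the
  least sum of neighbours passes the twin test in \<open>choices\<close>.
\<close>
lemma ex_twin_minimal:
  fixes E :: "nat \<Rightarrow> nat \<Rightarrow> bool"
  assumes "symp E" "i < n"
  obtains q where "q permutes {..<n}" "\<And>x. x \<le> i \<Longrightarrow> q x = x"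
    "\<And>x j. x < i \<Longrightarrow> E x (q j) = E x j"
    "\<And>a b. i < b \<Longrightarrow> b < a \<Longrightarrow> a < n \<Longrightarrow> E i (q a) \<Longrightarrow> \<not> E i (q b) \<Longrightarrow> \<exists>x<i. E x a \<noteq> E x b"
proof -
  define Q where "Q = {q. q permutes {..<n} \<and> (\<forall>x\<le>i. q x = x) \<and> (\<forall>x<i. \<forall>j. E x (q j) = E x j)}"
  define f where "f q = (\<Sum>j<n. of_bool (E i (q j)) * j)" for q :: "nat \<Rightarrow> nat"
  have "id \<in> Q" by (simp add: Q_def permutes_id)
  then obtain q where q: "q \<in> Q" and min: "\<And>q'. q' \<in> Q \<Longrightarrow> f q \<le> f q'"
    using ex_has_least_nat[of "\<lambda>q. q \<in> Q" id f] by blast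
  have "\<exists>x<i. E x a \<noteq> E x b"
    if ab: "i < b" "b < a" "a < n" "E i (q a)" "\<not> E i (q b)" for a b
  proof (rule ccontr)
    assume "\<not> (\<exists>x<i. E x a \<noteq> E x b)"
    then have twin: "E x a = E x b" if "x < i" for x using that by blast
    define q' where "q' = q \<circ> transpose a b"
    have "q' \<in> Q"
      using q ab twin unfolding Q_def q'_def
      by (auto simp: transpose_def intro!: permutes_compose permutes_swap_id)
    \<comment> \<open>The swap moves a neighbour from position \<open>a\<close> to the smaller
      position \<open>b\<close>, so the sum drops by \<open>a - b\<close>.\<close>
    moreover have "f q' < f q"
    proof -
      have split: "f p = of_bool (E i (p a)) * a + of_bool (E i (p b)) * b +
          (\<Sum>j\<in>{..<n} - {a} - {b}. of_bool (E i (p j)) * j)" for p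
        using ab by (simp add: f_def sum.remove[of "{..<n}" a] sum.remove[of "{..<n} - {a}" b])
      have "(\<Sum>j\<in>{..<n} - {a} - {b}. of_bool (E i (q' j)) * j) =
          (\<Sum>j\<in>{..<n} - {a} - {b}. of_bool (E i (q j)) * j)"
        by (intro sum.cong refl) (auto simp: q'_def)
      then show ?thesis
        using ab by (simp add: split[of q] split[of q']) (simp add: q'_def)
    qed
    ultimately show False using min[of q'] by simp
  qed
  then show thesis using q that by (auto simp: Q_def)
qed

text \<open>Downward induction from \<open>i = n\<close>, for all graphs at once: relabel so that
  row \<open>i\<close> passes the twin test, then apply the hypothesis to the relabelled graph. The
  state depends only on rows below \<open>i\<close>, which the relabelling preserves. As
  \<open>p\<close> fixes all \<open>x <= i\<close>, the case \<open>i = 0\<close> keeps the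
  root.\<close>

lemma search_complete:
  assumes "regular n r w E" "i \<le> n"
  shows "\<exists>p. p permutes {..<n} \<and> (\<forall>x\<le>i. p x = x) \<and>
    nbr_rows n (\<lambda>a b. E (p a) (p b)) \<in> set (search r w (entries n E i) (columns n E i))"
  using assms(2,1)
proof (induction i arbitrary: E rule: inc_induct)
  case base
  have "columns n E n = []" by (simp add: columns_def)
  moreover have "rev (map fst (entries n E n)) = nbr_rows n E"
    by (simp add: entries_def nbr_rows_def entry_def rev_map o_def)
  ultimately show ?case
    by (intro exI[of _ id]) (simp add: permutes_id[unfolded id_def])
next
  case (step i)
  have sym: "symp E" and irr: "irreflp E" using step.prems by (simp_all add: regular_def)
  obtain q where q: "q permutes {..<n}" "\<And>x. x \<le> i \<Longrightarrow> q x = x"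
    "\<And>x j. x < i \<Longrightarrow> E x (q j) = E x j"
    "\<And>a b. i < b \<Longrightarrow> b < a \<Longrightarrow> a < n \<Longrightarrow> E i (q a) \<Longrightarrow> \<not> E i (q b) \<Longrightarrow> \<exists>x<i. E x a \<noteq> E x b"
    using ex_twin_minimal[OF sym step.hyps(2)] by metis
  define F where "F = (\<lambda>a b. E (q a) (q b))"
  have F: "regular n r w F" unfolding F_def by (rule regular_permute[OF q(1) step.prems])
  then have symF: "symp F" and irrF: "irreflp F" by (simp_all add: regular_def)
  have Fl: "F x j = E x j" if "x < i" for x j
    using that q(2,3) by (simp add: F_def)
  have Fr: "F j x = E j x" if "x < i" for x j
    using Fl[OF that] symF sym by (metis sympD)
  have rows: "nbr_row n F x = nbr_row n E x" if "x < i" for x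
    using Fl[OF that] by (simp add: nbr_row_def)
  have entries: "entries n E i = entries n F i"
    by (auto simp: entries_def entry_def rows Fl intro!: sum.cong)
  have columns: "columns n E i = columns n F i"
    by (auto simp: columns_def Fr)
  define c cs S where "c = map (F i) (rev [0..<i])"
    and "cs = map (\<lambda>j. map (F j) (rev [0..<i])) [Suc i..<n]" and "S = map (F i) [Suc i..<n]"
  have cols: "columns n E i = c # cs"
    using columns columns_Cons[OF step.hyps(2), of F] by (simp add: c_def cs_def)
  have row: "nbr_row n F i = rev c @ False # S"
    unfolding c_def S_def by (rule nbr_row_split[OF irrF step.hyps(2)])
  have "trues (nbr_row n F i) = r"
    using F step.hyps(2) by (simp add: nbr_row_def trues_map regular_def lessThan_atLeast0)
  then have tr: "trues S = r - trues c" "\<not> r < trues c"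
    unfolding row by (auto simp: trues_append trues_rev)
  have "S \<in> set (choices (trues S) [] cs)"
  proof (rule choices_complete)
    fix a b assume ab: "a < length cs" "b < a" "S ! a" "\<not> S ! b"
    let ?a = "Suc i + a" and ?b = "Suc i + b"
    have lt: "a < n - Suc i" "b < n - Suc i" using ab by (simp_all add: cs_def)
    then have "\<exists>x<i. E x ?a \<noteq> E x ?b"
      using ab q(2)[of i] by (intro q(4)) (auto simp: S_def F_def)
    then obtain x where x: "x < i" "F x ?a \<noteq> F x ?b" using Fl by blast
    then have "F ?a x \<noteq> F ?b x" using symF by (metis sympD)
    with x(1) lt show "cs ! a \<noteq> cs ! b" by (auto simp: cs_def)
  qed (auto simp: S_def cs_def)
  moreover have "list_all (feasible (r - 1) w) (entries n F (Suc i))"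
    using F step.hyps(2) by (intro entries_feasible) auto
  moreover have "advance (rev c @ False # S) S (entries n F i) = entries n F (Suc i)"
    using advance_entries[OF symF irrF step.hyps(2)] row by (simp add: S_def)
  moreover have "map2 (#) S cs = columns n F (Suc i)"
    unfolding S_def cs_def by (rule columns_Suc[OF symF])
  ultimately have sub: "set (search r w (entries n F (Suc i)) (columns n F (Suc i))) \<subseteq>
      set (search r w (entries n E i) (columns n E i))"
    unfolding entries cols using tr by (auto simp: Let_def intro!: bexI[of _ S])
  obtain p where p: "p permutes {..<n}" "\<forall>x\<le>Suc i. p x = x"
    "nbr_rows n (\<lambda>a b. F (p a) (p b)) \<in> set (search r w (entries n F (Suc i)) (columns n F (Suc i)))"
    using step.IH[OF F] by blast
  show ?case
    using p q(2) sub permutes_compose[OF p(1) q(1)]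
    by (intro exI[of _ "q \<circ> p"]) (auto simp: F_def o_def)
qed

section \<open>Comparing the leaves\<close>

fun dot :: "int list \<Rightarrow> bool list \<Rightarrow> int" where
  "dot (x # xs) (b # bs) = (if b then x + dot xs bs else dot xs bs)"
| "dot _ _ = 0"

fun inner :: "int list \<Rightarrow> int list \<Rightarrow> int" where
  "inner (x # xs) (y # ys) = x * y + inner xs ys"
| "inner _ _ = 0"

text \<open>The product M A for symmetric A, whose rows serve as its columns.\<close>

definition mul :: "bool list list \<Rightarrow> int list list \<Rightarrow> int list list" where
  "mul A M = map (\<lambda>R. map (dot R) A) M"

definition to_int :: "bool list list \<Rightarrow> int list list" where
  "to_int A = map (map (\<lambda>b. if b then 1 else 0)) A"

text \<open>\<open>M\<close> is A^2 and \<open>N\<close> is A^3. By symmetry, inner products of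
  corresponding rows are the diagonals of A^4 and A^5.\<close>

definition closed_counts :: "bool list list \<Rightarrow> int list \<times> int list" where
  "closed_counts A =
     (let M = mul A (to_int A); N = mul A M in (map2 inner M M, map2 inner M N))"

definition walk_rows :: "nat \<Rightarrow> (nat \<Rightarrow> nat \<Rightarrow> bool) \<Rightarrow> nat \<Rightarrow> int list list" where
  "walk_rows n E k = map (\<lambda>i. map (walk n E k i) [0..<n]) [0..<n]"

lemma dot_map:
  "distinct xs \<Longrightarrow> dot (map f xs) (map g xs) = (\<Sum>x\<in>set xs. f x * of_bool (g x))"
  by (induction xs) auto

lemma inner_map:
  "distinct xs \<Longrightarrow> inner (map f xs) (map g xs) = (\<Sum>x\<in>set xs. f x * g x)"
  by (induction xs) auto

lemma to_int_nbr_rows: "to_int (nbr_rows n E) = walk_rows n E (Suc 0)"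
  by (auto simp: to_int_def nbr_rows_def nbr_row_def walk_rows_def walk_1 simp del: walk.simps)

lemma mul_walk_rows:
  assumes "symp E"
  shows "mul (nbr_rows n E) (walk_rows n E k) = walk_rows n E (Suc k)"
proof -
  have "E j x = E x j" for j x using assms by (metis sympD)
  then show ?thesis
    by (simp add: mul_def nbr_rows_def nbr_row_def walk_rows_def o_def dot_map lessThan_atLeast0)
qed

lemma map2_inner_walk_rows:
  assumes "symp E"
  shows "map2 inner (walk_rows n E j) (walk_rows n E k) = map (\<lambda>i. walk n E (j + k) i i) [0..<n]"
proof -
  have "(\<Sum>x<n. walk n E j i x * walk n E k i x) = walk n E (j + k) i i" if "i < n" for i
    unfolding walk_add[OF that] using that by (intro sum.cong refl) (simp add: walk_sym[OF assms, of i n _ k])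
  then show ?thesis
    by (auto simp: walk_rows_def map2_map_map inner_map lessThan_atLeast0)
qed

lemma closed_counts_nbr_rows:
  assumes "symp E"
  shows "closed_counts (nbr_rows n E) =
    (map (\<lambda>i. walk n E 4 i i) [0..<n], map (\<lambda>i. walk n E 5 i i) [0..<n])"
  by (simp add: closed_counts_def to_int_nbr_rows mul_walk_rows[OF assms]
      map2_inner_walk_rows[OF assms] eval_nat_numeral del: walk.simps)

lemma length_closed_counts: "length (fst (closed_counts A)) = length A"
  by (simp add: closed_counts_def mul_def to_int_def Let_def)

text \<open>Backtracking for an isomorphism from \<open>B\<close> to \<open>A\<close>:
  \<open>qs\<close> holds the images of the first vertices of \<open>B\<close>, latest first, and
  \<open>Rs\<close> the rows still to be placed. Comparing below the diagonal suffices for simple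
  graphs.\<close>

fun embeds :: "bool list list \<Rightarrow> nat list \<Rightarrow> bool list list \<Rightarrow> bool" where
  "embeds A qs [] \<longleftrightarrow> True"
| "embeds A qs (R # Rs) \<longleftrightarrow>
     list_ex (\<lambda>w. w \<notin> set qs \<and> map ((!) (A ! w)) qs = rev (take (length qs) R) \<and>
       embeds A (w # qs) Rs) [0..<length A]"

lemma embeds_sound:
  assumes "embeds A qs Rs" "Rs = drop (length qs) B" "length qs \<le> length B"
    and "distinct qs" "set qs \<subseteq> {..<length A}"
    and "\<And>a b. a < b \<Longrightarrow> b < length qs \<Longrightarrow> A ! (rev qs ! b) ! (rev qs ! a) = B ! b ! a"
  shows "\<exists>Q. take (length qs) Q = rev qs \<and> length Q = length B \<and> distinct Q \<and>
    set Q \<subseteq> {..<length A} \<and> (\<forall>a b. a < b \<longrightarrow> b < length B \<longrightarrow> A ! (Q ! b) ! (Q ! a) = B ! b ! a)"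
  using assms
proof (induction Rs arbitrary: qs)
  case Nil
  then have "length qs = length B" by simp
  then show ?case using Nil.prems by (intro exI[of _ "rev qs"]) auto
next
  case (Cons R Rs)
  from Cons.prems(1) obtain w where w: "w < length A" "w \<notin> set qs" "embeds A (w # qs) Rs"
    and R: "map ((!) (A ! w)) qs = rev (take (length qs) R)"
    by (auto simp: list_ex_iff)
  have len: "length qs < length B" using Cons.prems(2) by (metis drop_all leI list.distinct(1))
  have BR: "B ! length qs = R" using Cons.prems(2) len by (metis hd_drop_conv_nth list.sel(1))
  have "take (length qs) R = map ((!) (A ! w)) (rev qs)"
    using R by (metis rev_map rev_rev_ident)
  then have nth: "A ! w ! (rev qs ! a) = R ! a" if "a < length qs" for a
    using that by (metis length_rev nth_map nth_take)
  have nth': "A ! (rev (w # qs) ! b) ! (rev (w # qs) ! a) = B ! b ! a"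
    if "a < b" "b < length (w # qs)" for a b
    using that nth[of a] Cons.prems(6)[of a b] BR by (cases "b = length qs") (auto simp: nth_append)
  have "Rs = drop (length (w # qs)) B"
    using Cons.prems(2) by (metis drop_Suc length_Cons list.sel(3) tl_drop)
  then obtain Q where Q: "take (length (w # qs)) Q = rev (w # qs)" "length Q = length B" "distinct Q"
    "set Q \<subseteq> {..<length A}" "\<forall>a b. a < b \<longrightarrow> b < length B \<longrightarrow> A ! (Q ! b) ! (Q ! a) = B ! b ! a"
    using Cons.IH[OF w(3), OF _ _ _ _ nth'] Cons.prems(4,5) w(1,2) len by auto
  have "take (length qs) Q = take (length qs) (take (length (w # qs)) Q)" by simp
  also have "\<dots> = rev qs" unfolding Q(1) by simp
  finally show ?case using Q by blast
qed

definition const :: "int list \<Rightarrow> bool" where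
  "const xs \<longleftrightarrow> list_all ((=) (hd xs)) xs"

definition leaves :: "nat \<Rightarrow> nat \<Rightarrow> nat \<Rightarrow> (bool list list \<times> int list \<times> int list) list" where
  "leaves n r w = filter (\<lambda>(A, x, y). const x \<and> const y)
     (map (\<lambda>A. (A, closed_counts A)) (search r w [] (replicate n [])))"

text \<open>The first leaf with given counts represents all leaves with these counts. Starting with
  \<open>[0]\<close> and dropping the first row of \<open>B\<close> forces root to go to
  root.\<close>

definition check :: "nat \<Rightarrow> nat \<Rightarrow> nat \<Rightarrow> bool" where
  "check n r w \<longleftrightarrow>
     (let L = leaves n r w
      in list_all (\<lambda>(A, k). case find (\<lambda>(B, l). l = k) L of
           None \<Rightarrow> False
         | Some (B, l) \<Rightarrow> embeds A [0] (tl B)) L)"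

definition transitive :: "nat \<Rightarrow> (nat \<Rightarrow> nat \<Rightarrow> bool) \<Rightarrow> bool" where
  "transitive n E \<longleftrightarrow> (\<forall>u<n. \<forall>v<n. \<exists>p. bij_betw p {..<n} {..<n} \<and>
     (\<forall>i<n. \<forall>j<n. E (p i) (p j) = E i j) \<and> p u = v)"

lemma bij_betw_nth_lessThan:
  assumes "length Q = n" "distinct Q" "set Q \<subseteq> {..<n}"
  shows "bij_betw ((!) Q) {..<n} {..<n}"
proof -
  have "set Q = {..<n}"
    using assms by (intro card_subset_eq) (auto simp: distinct_card)
  then show ?thesis
    using assms by (intro bij_betw_nth) auto
qed

text \<open>
  Every vertex \<open>u\<close> is the root of some leaf; by walk-regularity these leaves carry the same counts,
  so \<open>check\<close> compares all of them with one and the same matrix \<open>B\<close>.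
\<close>
lemma check_transitive:
  assumes "check n r w" and reg: "regular n r w E" and wc: "walk_const n E"
  shows "transitive n E"
proof -
  have sym: "symp E" and irr: "irreflp E" using reg by (simp_all add: regular_def)
  obtain c d where c: "\<And>u. u < n \<Longrightarrow> walk n E 4 u u = c" and d: "\<And>u. u < n \<Longrightarrow> walk n E 5 u u = d"
    using wc unfolding walk_const_def by metis
  define K where "K = (replicate n c, replicate n d)"
  define B where "B = fst (the (find (\<lambda>(B, l). l = K) (leaves n r w)))"
  have root: "\<exists>t. bij_betw t {..<n} {..<n} \<and> t 0 = u \<and> (\<forall>a b. a < b \<longrightarrow> b < n \<longrightarrow> E (t b) (t a) = B ! b ! a)"
    if u: "u < n" for u
  proof -
    \<comment> \<open>The transposition makes \<open>u\<close> the root; \<open>p\<close> then fixes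
      0.\<close>
    define P where "P = transpose 0 u"
    have P: "P permutes {..<n}" using u unfolding P_def by (intro permutes_swap_id) auto
    have "entries n F 0 = []" "columns n F 0 = replicate n []" for F
      by (simp_all add: entries_def columns_def map_replicate_const)
    then obtain p where p: "p permutes {..<n}" "p 0 = 0"
      "nbr_rows n (\<lambda>a b. E (P (p a)) (P (p b))) \<in> set (search r w [] (replicate n []))"
      using search_complete[OF regular_permute[OF P reg], of 0] by auto
    define s where "s = P \<circ> p"
    define A where "A = nbr_rows n (\<lambda>a b. E (s a) (s b))"
    have s: "s permutes {..<n}" unfolding s_def by (rule permutes_compose[OF p(1) P])
    have lt: "s i < n" if "i < n" for i using permutes_in_image[OF s] that by auto
    have "symp (\<lambda>a b. E (s a) (s b))" using sym by (auto simp: symp_def)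
    from closed_counts_nbr_rows[OF this] have "closed_counts A = K"
      using c d lt by (auto simp: A_def K_def walk_permute[OF s] list_eq_iff_nth_eq)
    moreover have "const (replicate n x)" for x
      by (cases n) (auto simp: const_def list_all_iff)
    ultimately have "(A, K) \<in> set (leaves n r w)"
      using p(3) by (force simp: leaves_def A_def s_def K_def)
    with assms(1) obtain l where "find (\<lambda>(B, l). l = K) (leaves n r w) = Some (B, l)"
      and emb: "embeds A [0] (tl B)"
      unfolding check_def Let_def list_all_iff B_def by (fastforce split: option.splits)
    then have "(B, K) \<in> set (leaves n r w)"
      by (auto simp: find_Some_iff in_set_conv_nth)
    then have "closed_counts B = K" by (auto simp: leaves_def)
    then have "length B = n" using length_closed_counts[of B] by (simp add: K_def)
    moreover have "length A = n" by (simp add: A_def nbr_rows_def)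
    ultimately obtain Q where Q: "take (Suc 0) Q = [0]" "length Q = n" "distinct Q" "set Q \<subseteq> {..<n}"
      "\<forall>a b. a < b \<longrightarrow> b < n \<longrightarrow> A ! (Q ! b) ! (Q ! a) = B ! b ! a"
      using embeds_sound[OF emb, of B] u by (auto simp: drop_Suc)
    have bij: "bij_betw ((!) Q) {..<n} {..<n}" using Q by (intro bij_betw_nth_lessThan)
    have "s (Q ! 0) = u" using Q(1) p(2) by (cases Q) (auto simp: s_def P_def)
    moreover have "A ! (Q ! b) ! (Q ! a) = E (s (Q ! b)) (s (Q ! a))" if "a < n" "b < n" for a b
      using that bij by (auto simp: A_def nbr_rows_def nbr_row_def dest: bij_betwE)
    ultimately show ?thesis
      using Q(5) bij_betw_trans[OF bij permutes_imp_bij[OF s]]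
      by (intro exI[of _ "s \<circ> (!) Q"]) auto
  qed
  show ?thesis
    unfolding transitive_def
  proof (intro allI impI)
    fix u v assume "u < n" "v < n"
    then obtain f g where f: "bij_betw f {..<n} {..<n}" "f 0 = u" "\<forall>a b. a < b \<longrightarrow> b < n \<longrightarrow> E (f b) (f a) = B ! b ! a"
      and g: "bij_betw g {..<n} {..<n}" "g 0 = v" "\<forall>a b. a < b \<longrightarrow> b < n \<longrightarrow> E (g b) (g a) = B ! b ! a"
      using root by metis
    \<comment> \<open>Agreement below the diagonal extends to all pairs by symmetry and
      irreflexivity.\<close>
    have fg: "E (f a) (f b) = E (g a) (g b)" if "a < n" "b < n" for a b
    proof (cases a b rule: linorder_cases)
      case less
      then show ?thesis using f(3) g(3) that sym by (metis sympD)
    next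
      case equal
      then show ?thesis using irr by (simp add: irreflp_def)
    next
      case greater
      then show ?thesis using f(3) g(3) that by metis
    qed
    \<comment> \<open>Both labellings realise \<open>B\<close>, so undoing \<open>f\<close> and then
      applying \<open>g\<close> is an automorphism taking \<open>u\<close> to
      \<open>v\<close>.\<close>
    define h where "h = inv_into {..<n} f"
    have h: "bij_betw h {..<n} {..<n}" unfolding h_def by (rule bij_betw_inv_into[OF f(1)])
    have fh: "f (h i) = i" if "i < n" for i
      using that f(1) unfolding h_def by (simp add: bij_betw_inv_into_right)
    have hl: "h i < n" if "i < n" for i using h that by (auto dest: bij_betwE)
    have "h u = 0"
      using f(1,2) \<open>u < n\<close> unfolding h_def by (metis bij_betw_inv_into_left lessThan_iff gr_zeroI not_less_zero)
    then show "\<exists>p. bij_betw p {..<n} {..<n} \<and> (\<forall>i<n. \<forall>j<n. E (p i) (p j) = E i j) \<and> p u = v"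
      using fg fh hl g(2) bij_betw_trans[OF h g(1)]
      by (intro exI[of _ "g \<circ> h"]) (auto simp flip: fg)
  qed
qed

section \<open>Degree and triangle constraints, and the reduction to sparse graphs\<close>

lemma walk_2:
  assumes "symp E" "u < n" "v < n"
  shows "walk n E 2 u v = int (codeg n E u v)"
proof -
  have "walk n E 2 u v = (\<Sum>x<n. of_bool (E u x) * of_bool (E x v))"
    using walk_Suc_left[OF assms(2,3), of E "Suc 0"]
    by (simp add: numeral_2_eq_2 walk_1 assms(3) del: walk.simps)
  also have "\<dots> = int (codeg n E u v)"
    using sympD[OF assms(1)] by (auto simp: codeg_eq intro!: sum.cong)
  finally show ?thesis .
qed

text \<open>\<open>w\<close> counts ordered pairs of adjacent neighbours, hence is even, and
  \<open>n * w\<close> counts ordered triangles, which rotation groups in threes. These conditions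
  limit the pairs \<open>(r, w)\<close> to be searched.\<close>

lemma walk_const_regular:
  assumes sym: "symp E" and irr: "irreflp E" and wc: "walk_const n E" and n: "0 < n"
  obtains r w where "regular n r w E" "even (n * r)" "even w" "3 dvd n * w" "w \<le> r * (r - 1)"
proof -
  have E: "E i j = E j i" "\<not> E i i" for i j using sym irr by (metis sympD, simp add: irreflp_def)
  define r where "r = (\<Sum>j<n. of_bool (E 0 j) :: nat)"
  define w where "w = (\<Sum>j<n. of_bool (E 0 j) * codeg n E 0 j)"
  have r: "(\<Sum>j<n. of_bool (E i j)) = r" if "i < n" for i
  proof -
    have "walk n E 2 i i = walk n E 2 0 0" using wc that n unfolding walk_const_def by metis
    then have "codeg n E i i = codeg n E 0 0"
      using walk_2[OF sym that that] walk_2[OF sym n n] by simp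
    then show ?thesis by (simp add: codeg_eq r_def flip: of_bool_conj)
  qed
  have w: "(\<Sum>j<n. of_bool (E i j) * codeg n E i j) = w" if "i < n" for i
  proof -
    have 3: "walk n E 3 i i = int (\<Sum>j<n. of_bool (E i j) * codeg n E i j)" if "i < n" for i
    proof -
      have "walk n E 3 i i = (\<Sum>x<n. of_bool (E i x) * walk n E 2 x i)"
        using walk_Suc_left[OF that that, of E 2] by (simp only: eval_nat_numeral)
      also have "\<dots> = (\<Sum>x<n. of_bool (E i x) * int (codeg n E i x))"
        by (intro sum.cong refl) (simp add: walk_2[OF sym _ that] codeg_commute del: walk.simps)
      finally show ?thesis by simp
    qed
    have "walk n E 3 i i = walk n E 3 0 0" using wc that n unfolding walk_const_def by metis
    then show ?thesis unfolding w_def 3[OF that] 3[OF n] of_nat_eq_iff .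
  qed
  have reg: "regular n r w E" using sym irr r w by (simp add: regular_def)
  have "even (n * r)"
    using even_sum_symmetric[of "\<lambda>i j. of_bool (E i j)" n] r E by simp
  moreover have "even w"
  proof -
    let ?m = "\<lambda>j x. of_bool (E 0 j) * (of_bool (E 0 x) * of_bool (E j x)) :: nat"
    have "w = (\<Sum>j<n. \<Sum>x<n. ?m j x)" by (simp add: w_def codeg_eq sum_distrib_left)
    moreover have "?m i j = ?m j i" "?m i i = 0" for i j using E by auto
    ultimately show ?thesis using even_sum_symmetric[of ?m n] by presburger
  qed
  moreover have "3 dvd n * w"
  proof -
    let ?m = "\<lambda>i j x. of_bool (E i j) * (of_bool (E i x) * of_bool (E j x)) :: nat"
    have "n * w = (\<Sum>i<n. \<Sum>j<n. of_bool (E i j) * codeg n E i j)" using w by simp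
    also have "\<dots> = (\<Sum>i<n. \<Sum>j<n. \<Sum>x<n. ?m i j x)" by (simp add: codeg_eq sum_distrib_left)
    moreover have "?m i j k = ?m j k i" "?m i i k = 0" for i j k using E by auto
    ultimately show ?thesis using three_dvd_sum_cyclic[of ?m n] by presburger
  qed
  moreover have "w \<le> r * (r - 1)"
  proof -
    have "w \<le> (\<Sum>j<n. of_bool (E 0 j) * (r - 1))"
      using codeg_less[OF reg _ n] unfolding w_def by (intro sum_mono) auto
    then show ?thesis by (simp add: r_def sum_distrib_right)
  qed
  ultimately show thesis using that reg by blast
qed

definition instances :: "nat \<Rightarrow> (nat \<times> nat) list" where
  "instances n = concat (map (\<lambda>r. map (Pair r) (filter (\<lambda>w. even w \<and> 3 dvd n * w) [0..<Suc (r * (r - 1))]))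
     (filter (\<lambda>r. 2 * r < n \<and> even (n * r)) [0..<n]))"

definition check_order :: "nat \<Rightarrow> bool" where
  "check_order n \<longleftrightarrow> list_all (\<lambda>(r, w). check n r w) (instances n)"

text \<open>The degrees of a graph and its complement add up to \<open>n - 1\<close>, so one of them
  is below \<open>n / 2\<close>, and both graphs have the same automorphisms.\<close>

lemma check_order_transitive:
  assumes "check_order n" "symp E" "irreflp E" "walk_const n E"
  shows "transitive n E"
proof (cases "n = 0")
  case False
  have sparse: "transitive n F"
    if F: "symp F" "irreflp F" "walk_const n F" and reg: "regular n r w F" and r: "2 * r < n" for F r w
  proof -
    obtain r' w' where *: "regular n r' w' F" "even (n * r')" "even w'" "3 dvd n * w'" "w' \<le> r' * (r' - 1)"
      using walk_const_regular[OF F] False by auto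
    have "r' = r" using *(1) reg False by (auto simp: regular_def)
    then have "(r', w') \<in> set (instances n)"
      using * r by (auto simp: instances_def less_Suc_eq_le simp del: upt_Suc intro!: exI[of _ r])
    then have "check n r' w'" using assms(1) by (auto simp: check_order_def list_all_iff)
    then show ?thesis using check_transitive *(1) F(3) by blast
  qed
  have c: "symp (compl E)" "irreflp (compl E)"
    using assms by (auto simp: compl_def symp_def irreflp_def)
  note cw = walk_const_compl[OF assms(2-4)]
  obtain r w where r: "regular n r w E" using walk_const_regular[OF assms(2-4)] False by blast
  obtain s x where s: "regular n s x (compl E)" using walk_const_regular[OF c cw] False by blast
  have "int s = int (\<Sum>j<n. of_bool (compl E 0 j))"
    using s False by (simp add: regular_def)
  also have "\<dots> = (\<Sum>j<n. 1 - of_bool (0 = j) - of_bool (E 0 j))"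
    using assms(3) by (simp add: of_bool_compl irreflp_def)
  also have "\<dots> = int n - 1 - int (\<Sum>j<n. of_bool (E 0 j))"
    using False sum_of_bool_delta(2)[of 0 n "\<lambda>_. 1::int"] by (simp add: sum_subtractf)
  also have "\<dots> = int n - 1 - int r" using r False by (simp add: regular_def)
  finally have "2 * r < n \<or> 2 * s < n" by linarith
  then show ?thesis
  proof
    assume "2 * s < n"
    then have "transitive n (compl E)" using sparse[OF c cw s] by blast
    show ?thesis
      unfolding transitive_def
    proof (intro allI impI)
      fix u v assume "u < n" "v < n"
      with \<open>transitive n (compl E)\<close> obtain p where p: "bij_betw p {..<n} {..<n}" "p u = v"
        "\<And>i j. i < n \<Longrightarrow> j < n \<Longrightarrow> compl E (p i) (p j) = compl E i j"
        unfolding transitive_def by meson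
      have "E (p i) (p j) = E i j" if "i < n" "j < n" for i j
      proof (cases "i = j")
        case False
        then have "p i \<noteq> p j" using p(1) that by (auto simp: bij_betw_def dest: inj_onD)
        then show ?thesis using p(3)[OF that] False by (simp add: compl_def)
      qed (use assms(3) in \<open>simp add: irreflp_def\<close>)
      with p show "\<exists>p. bij_betw p {..<n} {..<n} \<and> (\<forall>i<n. \<forall>j<n. E (p i) (p j) = E i j) \<and> p u = v"
        by blast
    qed
  qed (use sparse assms r in blast)
qed (simp add: transitive_def)

section \<open>Transfer between pair graphs and relations on indices\<close>

lemma adj_mat_pow:
  assumes "i < length vs" "j < length vs"
  shows "(adj_mat G vs ^\<^sub>m k) $$ (i, j) =
    walk (length vs) (\<lambda>i j. (vs ! i, vs ! j) \<in> parcs G) k i j"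
  using assms
proof (induction k arbitrary: j)
  case 0
  then show ?case by (simp add: adj_mat_def)
next
  case (Suc k)
  have A: "adj_mat G vs \<in> carrier_mat (length vs) (length vs)" by (simp add: adj_mat_def)
  have P: "adj_mat G vs ^\<^sub>m k \<in> carrier_mat (length vs) (length vs)" by (rule pow_carrier_mat[OF A])
  have "adj_mat G vs $$ (x, j) = of_bool ((vs ! x, vs ! j) \<in> parcs G)" if "x < length vs" for x
    using that Suc.prems by (simp add: adj_mat_def)
  then show ?case
    using Suc A P by (simp add: scalar_prod_def lessThan_atLeast0)
qed

lemma walk_regular_iff:
  "walk_regular G \<longleftrightarrow> (\<exists>vs. distinct vs \<and> set vs = pverts G \<and>
     walk_const (length vs) (\<lambda>i j. (vs ! i, vs ! j) \<in> parcs G))"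
proof -
  have "(\<forall>u<n. \<forall>v<n. f u = f v) \<longleftrightarrow> (\<exists>c. \<forall>u<n. f u = c)" for f :: "nat \<Rightarrow> int" and n :: nat
    by (cases n) (auto intro!: exI[of _ "f 0"])
  then show ?thesis
    by (simp add: walk_regular_def walk_const_def adj_mat_pow cong: conj_cong)
qed

lemma (in pair_graph) vertex_transitiveI:
  assumes "distinct vs" "set vs = pverts G"
    and trans: "transitive (length vs) (\<lambda>i j. (vs ! i, vs ! j) \<in> parcs G)"
  shows "vertex_transitive G"
  unfolding vertex_transitive_def
proof (intro ballI)
  fix u v assume "u \<in> pverts G" "v \<in> pverts G"
  define n where "n = length vs"
  define h where "h = inv_into {..<n} ((!) vs)"
  have nth: "bij_betw ((!) vs) {..<n} (pverts G)"
    using assms(1,2) by (intro bij_betw_nth) (auto simp: n_def)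
  then have h: "bij_betw h (pverts G) {..<n}" unfolding h_def by (rule bij_betw_inv_into)
  have hl: "h x < n" and vh: "vs ! h x = x" if "x \<in> pverts G" for x
    using h bij_betw_inv_into_right[OF nth that] that by (auto simp: h_def dest: bij_betwE)
  obtain p where p: "bij_betw p {..<n} {..<n}" "p (h u) = h v"
    "\<And>i j. i < n \<Longrightarrow> j < n \<Longrightarrow> (vs ! p i, vs ! p j) \<in> parcs G \<longleftrightarrow> (vs ! i, vs ! j) \<in> parcs G"
    using trans hl \<open>u \<in> _\<close> \<open>v \<in> _\<close> unfolding transitive_def n_def[symmetric] by meson
  show "similar G u v"
    unfolding similar_iff
    using bij_betw_trans[OF bij_betw_trans[OF h p(1)] nth] p(2,3) hl vh \<open>u \<in> _\<close> \<open>v \<in> _\<close>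
    by (intro exI[of _ "(!) vs \<circ> (p \<circ> h)"]) auto
qed

section \<open>Evaluation of the search for all orders below 12\<close>

lemma check_order_small: "list_all check_order [0..<8]"
  by code_simp

lemma check_order_8: "check_order 8"
  by code_simp

lemma check_order_9: "check_order 9"
  by code_simp

lemma check_order_10: "check_order 10"
  by code_simp

lemma check_order_11: "check_order 11"
  by code_simp

lemma check_orders: "n < 12 \<Longrightarrow> check_order n"
proof -
  assume "n < 12"
  then have "n \<in> set ([0..<8] @ [8, 9, 10, 11])" by auto
  then show ?thesis
    using check_order_small check_order_8 check_order_9 check_order_10 check_order_11
    by (auto simp: list_all_iff)
qed

lemma walk_regular_vertex_transitive:
  assumes "pair_graph G" "card (pverts G) < 12" "walk_regular G"
  shows "vertex_transitive G"
proof -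
  interpret pair_graph G by fact
  obtain vs where vs: "distinct vs" "set vs = pverts G"
    "walk_const (length vs) (\<lambda>i j. (vs ! i, vs ! j) \<in> parcs G)"
    using assms(3) by (auto simp: walk_regular_iff)
  have "length vs < 12" using vs(1,2) assms(2) by (metis distinct_card)
  moreover have "symp (\<lambda>i j. (vs ! i, vs ! j) \<in> parcs G)"
    using pair_sym_arcs by (auto simp: symp_def symmetric_def sym_def)
  moreover have "irreflp (\<lambda>i j. (vs ! i, vs ! j) \<in> parcs G)"
    using pair_no_loops by (fastforce simp: irreflp_def)
  ultimately show ?thesis
    using vs check_orders by (intro vertex_transitiveI check_order_transitive)
qed

section \<open>The example on 12 vertices\<close>

definition nbrs12 :: "nat list list" where
  "nbrs12 = [[1, 2, 3, 4], [0, 2, 3, 5], [0, 1, 6, 7], [0, 1, 8, 9], [0, 5, 10, 11], [1, 4, 10, 11],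
     [2, 7, 8, 10], [2, 6, 9, 10], [3, 6, 9, 11], [3, 7, 8, 11], [4, 5, 6, 7], [4, 5, 8, 9]]"

definition E12 :: "nat \<Rightarrow> nat \<Rightarrow> bool" where
  "E12 i j \<longleftrightarrow> i < 12 \<and> j < 12 \<and> j \<in> set (nbrs12 ! i)"

definition G12 :: "nat pair_pre_digraph" where
  "G12 = \<lparr>pverts = {..<12}, parcs = {(i, j). E12 i j}\<rparr>"

lemma G12_simps [simp]:
  "pverts G12 = {..<12}" "(i, j) \<in> parcs G12 \<longleftrightarrow> E12 i j"
  by (simp_all add: G12_def)

lemma E12_mem: "E12 i j \<Longrightarrow> i \<in> set [0..<12] \<and> j \<in> set [0..<12]"
  by (simp add: E12_def)

lemma E12_sym: "symp E12"
proof -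
  have "\<forall>i\<in>set [0..<12]. \<forall>j\<in>set [0..<12]. E12 i j \<longrightarrow> E12 j i"
    by code_simp
  then show ?thesis using E12_mem by (blast intro: sympI)
qed

lemma E12_irrefl: "irreflp E12"
proof -
  have "\<forall>i\<in>set [0..<12]. \<not> E12 i i"
    by code_simp
  then show ?thesis using E12_mem by (blast intro: irreflpI)
qed

lemma E12_degree: "x < 12 \<Longrightarrow> (\<Sum>y<12. of_bool (E12 x y)) = (4::int)"
proof -
  have "\<forall>x\<in>set [0..<12]. trues (nbr_row 12 E12 x) = 4"
    by code_simp
  then have "(\<Sum>y<12. of_bool (E12 x y)) = (4::nat)" if "x < 12" for x
    using that by (simp add: nbr_row_def trues_map lessThan_atLeast0)
  then show "x < 12 \<Longrightarrow> ?thesis"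
    by (metis (mono_tags, lifting) of_nat_numeral of_nat_of_bool of_nat_sum sum.cong)
qed

text \<open>The adjacency matrix satisfies \<open>A\<^sup>3 = 4A + 4J\<close>, since the eigenvalues are 4, 2, 0 and -2.\<close>
lemma walk_3_E12:
  assumes "i < 12" "j < 12"
  shows "walk 12 E12 3 i j = 4 * of_bool (E12 i j) + 4"
proof -
  have "mul (nbr_rows 12 E12) (mul (nbr_rows 12 E12) (to_int (nbr_rows 12 E12))) =
      map (map (\<lambda>b. if b then 8 else 4)) (nbr_rows 12 E12)"
    by code_simp
  then have "walk_rows 12 E12 3 = map (map (\<lambda>b. if b then 8 else 4)) (nbr_rows 12 E12)"
    unfolding to_int_nbr_rows mul_walk_rows[OF E12_sym] by (simp only: numeral_3_eq_3)
  then have "\<forall>i<12. \<forall>j<12. walk 12 E12 3 i j = (if E12 i j then 8 else 4)"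
    by (simp add: walk_rows_def nbr_rows_def nbr_row_def del: upt_conv_Cons)
  then show ?thesis using assms by simp
qed

text \<open>Multiplying A^3 = 4A + 4J by A^m, where A^m J = 4^m J, reduces the diagonal of A^(m+3)
  to that of A^(m+1). Lengths 0, 1 and 2 hold by the identity, the absence of loops and the
  degree.\<close>

lemma walk_const_E12: "walk_const 12 E12"
proof -
  have "\<exists>c. \<forall>u<12. walk 12 E12 k u u = c" for k
  proof (induction k rule: less_induct)
    case (less k)
    consider "k = 0" | "k = 1" | "k = 2" | m where "k = Suc m + 2" 
      by (metis One_nat_def Suc_1 add_2_eq_Suc' not0_implies_Suc)
    then show ?case
    proof cases
      case 2
      then have "walk 12 E12 k u u = 0" if "u < 12" for u
        using that E12_irrefl by (simp add: walk_1 irreflp_def del: walk.simps)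
      then show ?thesis by blast
    next
      case 3
      have "walk 12 E12 k u u = 4" if "u < 12" for u
        using walk_2[OF E12_sym that that] E12_degree[OF that]
        by (simp add: 3 codeg_eq flip: of_bool_conj)
      then show ?thesis by blast
    next
      case (4 m)
      obtain c where c: "\<forall>u<12. walk 12 E12 (Suc m) u u = c" using less[of "Suc m"] 4 by (auto simp del: walk.simps)
      have "walk 12 E12 k u u = 4 * c + 4 * 4 ^ m" if u: "u < 12" for u
      proof -
        have "walk 12 E12 k u u = (\<Sum>x<12. walk 12 E12 m u x * walk 12 E12 3 x u)"
          using walk_add[OF u, of E12 m 3 u] by (simp add: 4 numeral_3_eq_3)
        also have "\<dots> = (\<Sum>x<12. 4 * (walk 12 E12 m u x * of_bool (E12 x u)) + 4 * walk 12 E12 m u x)"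
          using u by (intro sum.cong refl) (simp add: walk_3_E12 distrib_left)
        also have "\<dots> = 4 * walk 12 E12 (Suc m) u u + 4 * 4 ^ m"
          by (simp add: sum.distrib walk_row_sum[OF E12_degree u] flip: sum_distrib_left)
        finally show ?thesis using c u by simp
      qed
      then show ?thesis by blast
    qed auto
  qed
  then show ?thesis by (simp add: walk_const_def)
qed

lemma pair_graph_G12: "pair_graph G12"
proof
  have "parcs G12 \<subseteq> {..<12} \<times> {..<12}" by (auto simp: E12_def)
  then show "finite (parcs G12)" by (rule finite_subset) auto
  show "symmetric G12"
    using E12_sym by (auto simp: symmetric_def sym_def symp_def)
qed (use E12_irrefl in \<open>auto simp: irreflp_def E12_def\<close>)

lemma connected_G12: "connected (with_proj G12)"
proof -
  interpret pair_graph G12 by (rule pair_graph_G12)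
  \<comment> \<open>Every vertex except 0 has a neighbour with a smaller label, so descending labels
    lead to 0.\<close>
  have parent: "\<forall>v\<in>set [1..<12]. \<exists>u\<in>set [0..<v]. E12 u v"
    by code_simp
  have r: "0 \<rightarrow>\<^sup>*\<^bsub>G12\<^esub> v" if "v < 12" for v
    using that
  proof (induction v rule: less_induct)
    case (less v)
    show ?case
    proof (cases "v = 0")
      case False
      then obtain u where "u < v" "E12 u v" using parent less.prems by force
      then have "0 \<rightarrow>\<^sup>*\<^bsub>G12\<^esub> u" "(u, v) \<in> parcs G12" using less by auto
      then show ?thesis by (rule reachable_adj_trans)
    qed (simp add: reachable_refl)
  qed
  have "u \<rightarrow>\<^sup>*\<^bsub>mk_symmetric G12\<^esub> v" if "u < 12" "v < 12" for u v
    using that symmetric_reachable[OF pair_sym_arcs r] r reachable_trans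
    by (simp add: reachable_mk_symmetric_eq[OF pair_sym_arcs]) blast
  then show ?thesis
    by (intro connectedI) (auto simp: lessThan_empty_iff)
qed

lemma not_similar_G12: "\<not> similar G12 0 2"
proof
  interpret pair_graph G12 by (rule pair_graph_G12)
  assume "similar G12 0 2"
  then obtain p where p: "bij_betw p {..<12} {..<12}" "p 0 = 2"
    "\<And>x y. x < 12 \<Longrightarrow> y < 12 \<Longrightarrow> E12 (p x) (p y) = E12 x y"
    by (auto simp: similar_iff)
  \<comment> \<open>The edge between 0 and 4 lies in no triangle, while every edge at 2 lies in
    one.\<close>
  have 0: "E12 0 4" "\<forall>z\<in>set [0..<12]. \<not> (E12 0 z \<and> E12 4 z)"
    "\<forall>x\<in>set [0..<12]. E12 2 x \<longrightarrow> (\<exists>z\<in>set [0..<12]. E12 2 z \<and> E12 x z)"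
    by code_simp+
  have "E12 2 (p 4)" using p(3)[of 0 4] p(2) 0(1) by simp
  then obtain z where z: "z \<in> {..<12}" "E12 2 z" "E12 (p 4) z"
    using 0(3) E12_mem by (metis atLeast_upt lessThan_iff set_upt atLeastLessThan_iff)
  \<comment> \<open>Pulling the common neighbour of 2 and \<open>p 4\<close> back along
    \<open>p\<close> gives one of 0 and 4.\<close>
  then obtain y where y: "y < 12" "p y = z"
    using p(1) unfolding bij_betw_def by (metis imageE lessThan_iff)
  then have "E12 0 y" "E12 4 y" using p(3)[of 0 y] p(3)[of 4 y] p(2) y z by simp_all
  then show False using 0(2) y(1) by simp
qed

lemma walk_regular_G12: "walk_regular G12"
proof -
  have "walk 12 (\<lambda>i j. ([0..<12] ! i, [0..<12] ! j) \<in> parcs G12) k u v = walk 12 E12 k u v"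
    if "v < 12" for k u v
    using that by (induction k arbitrary: v) (auto intro!: sum.cong)
  then have "walk_const 12 (\<lambda>i j. ([0..<12] ! i, [0..<12] ! j) \<in> parcs G12)"
    using walk_const_E12 by (simp add: walk_const_def)
  then show ?thesis
    unfolding walk_regular_iff by (intro exI[of _ "[0..<12]"]) auto
qed

theorem theorem1p4:
  shows "(\<exists>G :: nat pair_pre_digraph.
            pair_graph G \<and> connected (with_proj G) \<and> card (pverts G) = 12 \<and> walk_regular G \<and>
            (\<exists>u \<in> pverts G. \<exists>v \<in> pverts G. \<not> similar G u v)) \<and>
         (\<forall>G :: 'a pair_pre_digraph.
            pair_graph G \<and> connected (with_proj G) \<and> card (pverts G) < 12 \<and> walk_regular G \<longrightarrow>
            vertex_transitive G)"
proof (intro conjI allI impI)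
  have "0 \<in> pverts G12" "2 \<in> pverts G12" "card (pverts G12) = 12" by simp_all
  then show "\<exists>G :: nat pair_pre_digraph.
      pair_graph G \<and> connected (with_proj G) \<and> card (pverts G) = 12 \<and> walk_regular G \<and>
      (\<exists>u \<in> pverts G. \<exists>v \<in> pverts G. \<not> similar G u v)"
    using pair_graph_G12 connected_G12 walk_regular_G12 not_similar_G12 by blast
qed (use walk_regular_vertex_transitive in blast)

end
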